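(* Let $\mathbf{B}=\{b_i=(\delta_i,\phi_i,B_i)\mid i=0,\dots,5\}$ be an arbitrary basis of the real algebra $A=\mathbb{R}\oplus\mathbb{R}\oplus M_2(\mathbb{R})$, where $\delta_i,\phi_i\in\mathbb{R}$ and $B_i\in M_2(\mathbb{R})$, and let $P(\mathbf{B})$ be the transition matrix between the bases $\mathbf{E}$ and $\mathbf{B}$ (see context). Then $\mathbf{B}$ is a standard RBA$^{\delta}$-basis of $A$ with respect to the involution $(x,y,Z)^*=(x,y,Z^{\top})$ and the degree map $\delta((x,y,Z))=x$ if and only if, up to renumbering the elements of $\mathbf{B}$, the following conditions hold. (i) $\delta_i>0$ for $i=0,\dots,5$, $\delta_0=\phi_0=1$ and $B_0=I_2$. (ii) $\phi_5=\phi_4$, $\delta_5=\delta_4$, $B_i^{\top}=B_i$ for $i=1,2,3$, and $B_4^{\top}=B_5$. (iii) Put $n:=\sum_{i=0}^5\delta_i$, $m_\delta:=1$, $m_\phi:=\dfrac{n}{\sum_{i=0}^5\phi_i^2/\delta_i}$ and $m_\chi:=\dfrac{n-1-m_\phi}{2}$. Then $m_\chi>0$ and $$\big(P(\mathbf{B})_i,P(\mathbf{B})_j\big)_\delta=\frac{n}{m_i}\,\delta_{ij},\qquad 0\le i,j\le 5,$$ where $P(\mathbf{B})_i$ is the $i$-th row of $P(\mathbf{B})$ (rows indexed from $0$), $\delta_{ij}$ is the Kronecker delta, $m_0=m_\delta$, $m_1=m_\phi$, $m_2=m_3=m_4=m_5=m_\chi$, and $(u,v)_\delta:=\sum_{k=0}^5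 u_kv_k\delta_k^{-1}$ for $u,v\in\mathbb{R}^6$.
   Context: An RBA-basis of a finite-dimensional algebra with involution $*$ is a basis $\mathbf{B}=\{b_0,\dots,b_{r-1}\}$ such that: (1) $b_0$ is the identity; (2) the structure constants $\lambda_{ijk}$ in $b_ib_j=\sum_k\lambda_{ijk}b_k$ are real; (3) $\mathbf{B}^*=\mathbf{B}$, and one writes $b_{i^*}=(b_i)^*$; (4) $\lambda_{ij0}\ne0$ if and only if $j=i^*$; (5) $\lambda_{ii^*0}=\lambda_{i^*i0}>0$. (Reality-based algebras are defined over $\mathbb{C}$ with conjugate-semilinear involution; here one works with the real span $\mathbb{R}\mathbf{B}$, i.e. a basis of the real algebra $A$ is regarded as a basis of $A\otimes_{\mathbb{R}}\mathbb{C}$ with $*$ extended conjugate-linearly.) It is an RBA$^{\delta}$-basis if $\delta$ is a one-dimensional algebra homomorphism with $\delta(a^* )=\overline{\delta(a)}$ for all $a$ and $\delta(b_i)>0$ for all $i$ (a positive degree map); it is standard if moreover $\delta(b_i)=\lambda_{ii^*0}$ for all $i$. $\mathbf{E}=\{e_0,\dots,e_5\}$ is the basis of $A=\mathbb{R}\oplus\mathbb{R}\oplus M_2(\mathbb{R})$ given by $e_0=(1,0,0)$, $e_1=(0,1,0)$, $e_2=(0,0,E_{11})$, $e_3=(0,0,E_{22})$, $e_4=(0,0,E_{12})$, $e_5=(0,0,E_{21})$, where $E_{ij}$ are the matrix units of $M_2(\mathbb{R})$. The transition matrix $P(\mathbf{B})$ is defined by $b_j=\sum_{i=0}^5P(\mathbf{B})_{ij}e_i$,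 i.e. its $j$-th column is the coordinate vector of $b_j$ in the basis $\mathbf{E}$. *)

theory Defs
  imports "HOL-Analysis.Analysis"
begin

section \<open>Reality-based algebras\<close>

text \<open>Complex algebras with a conjugate-semilinear involution. Multiplication, unit and involution
  are parameters: the type classes would force the componentwise product on matrices.\<close>

locale complex_star_algebra = vector_space scale
  for scale :: "complex \<Rightarrow> 'a::ab_group_add \<Rightarrow> 'a" +
  fixes mult :: "'a \<Rightarrow> 'a \<Rightarrow> 'a"
    and unit :: 'a
    and star :: "'a \<Rightarrow> 'a"
  assumes mult_assoc: "mult (mult x y) z = mult x (mult y z)"
    and mult_unit_left: "mult unit x = x"
    and mult_unit_right: "mult x unit = x"
    and mult_add_left: "mult (x + y) z = mult x z + mult y z"
    and mult_add_right: "mult x (y + z) = mult x y + mult x z"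
    and mult_scale_left: "mult (scale c x) y = scale c (mult x y)"
    and mult_scale_right: "mult x (scale c y) = scale c (mult x y)"
    and star_add: "star (x + y) = star x + star y"
    and star_scale: "star (scale c x) = scale (cnj c) (star x)"
    and star_star: "star (star x) = x"
    and star_mult: "star (mult x y) = mult (star y) (star x)"
begin

text \<open>The structure constant \<open>\<lambda>\<^sub>i\<^sub>j\<^sub>k\<close> is \<open>struct_const \<B> b\<^sub>i b\<^sub>j b\<^sub>k\<close>: the coefficient
  of \<open>b\<^sub>k\<close> in \<open>b\<^sub>i b\<^sub>j\<close>.\<close>

definition struct_const :: "'a set \<Rightarrow> 'a \<Rightarrow> 'a \<Rightarrow> 'a \<Rightarrow> complex" where
  "struct_const \<B> x y z = representation \<B> (mult x y) z"

text \<open>A basis is a set here, so no numbering is chosen: \<open>b\<^sub>0\<close> is the element \<open>unit\<close> and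
  \<open>b\<^sub>i\<^sub>*\<close> is \<open>star b\<^sub>i\<close>. Since all structure constants are required to be real, positivity in
  the last condition is that of the real part.\<close>

definition RBA_basis :: "'a set \<Rightarrow> bool" where
  "RBA_basis \<B> \<longleftrightarrow>
     finite \<B> \<and> independent \<B> \<and> span \<B> = UNIV \<and>
     unit \<in> \<B> \<and>
     (\<forall>x\<in>\<B>. \<forall>y\<in>\<B>. \<forall>z\<in>\<B>. struct_const \<B> x y z \<in> \<real>) \<and>
     star ` \<B> = \<B> \<and>
     (\<forall>x\<in>\<B>. \<forall>y\<in>\<B>. struct_const \<B> x y unit \<noteq> 0 \<longleftrightarrow> y = star x) \<and>
     (\<forall>x\<in>\<B>. struct_const \<B> x (star x) unit = struct_const \<B> (star x) x unit \<and>
             Re (struct_const \<B> x (star x) unit) > 0)"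

definition one_dim_hom :: "('a \<Rightarrow> complex) \<Rightarrow> bool" where
  "one_dim_hom d \<longleftrightarrow>
     (\<forall>x y. d (x + y) = d x + d y) \<and> (\<forall>c x. d (scale c x) = c * d x) \<and>
     (\<forall>x y. d (mult x y) = d x * d y) \<and> d unit = 1"

definition RBA_delta_basis :: "'a set \<Rightarrow> ('a \<Rightarrow> complex) \<Rightarrow> bool" where
  "RBA_delta_basis \<B> d \<longleftrightarrow>
     RBA_basis \<B> \<and> one_dim_hom d \<and> (\<forall>x. d (star x) = cnj (d x)) \<and>
     (\<forall>x\<in>\<B>. d x \<in> \<real> \<and> Re (d x) > 0)"

definition standard_RBA_delta_basis :: "'a set \<Rightarrow> ('a \<Rightarrow> complex) \<Rightarrow> bool" where
  "standard_RBA_delta_basis \<B> d \<longleftrightarrow>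
     RBA_delta_basis \<B> d \<and> (\<forall>x\<in>\<B>. d x = struct_const \<B> x (star x) unit)"

end


section \<open>The algebra \<open>\<real> \<oplus> \<real> \<oplus> M\<^sub>2(\<real>)\<close> and its complexification\<close>

type_synonym alg = "real \<times> real \<times> (real^2^2)"
type_synonym calg = "complex \<times> complex \<times> (complex^2^2)"

fun alg_mult :: "alg \<Rightarrow> alg \<Rightarrow> alg" where
  "alg_mult (x, y, Z) (x', y', Z') = (x * x', y * y', Z ** Z')"

fun alg_star :: "alg \<Rightarrow> alg" where
  "alg_star (x, y, Z) = (x, y, transpose Z)"

fun alg_degree :: "alg \<Rightarrow> real" where
  "alg_degree (x, y, Z) = x"

fun calg_scale :: "complex \<Rightarrow> calg \<Rightarrow> calg" where
  "calg_scale c (x, y, Z) = (c * x, c * y, map_matrix ((*) c) Z)"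

fun calg_mult :: "calg \<Rightarrow> calg \<Rightarrow> calg" where
  "calg_mult (x, y, Z) (x', y', Z') = (x * x', y * y', Z ** Z')"

definition calg_unit :: calg where
  "calg_unit = (1, 1, mat 1)"

fun calg_star :: "calg \<Rightarrow> calg" where
  "calg_star (x, y, Z) = (cnj x, cnj y, map_matrix cnj (transpose Z))"

fun calg_degree :: "calg \<Rightarrow> complex" where
  "calg_degree (x, y, Z) = x"

fun complexify :: "alg \<Rightarrow> calg" where
  "complexify (x, y, Z) = (of_real x, of_real y, map_matrix of_real Z)"

interpretation calg: complex_star_algebra calg_scale calg_mult calg_unit calg_star
proof
  fix x y z :: calg and c d :: complex
  obtain x1 x2 X where x: "x = (x1, x2, X)" by (cases x)
  obtain y1 y2 Y where y: "y = (y1, y2, Y)" by (cases y)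
  obtain z1 z2 Z where z: "z = (z1, z2, Z)" by (cases z)
  note s = x y z calg_unit_def vec_eq_iff matrix_matrix_mult_def transpose_def sum_2 mat_def
    algebra_simps
  show "calg_scale c (x + y) = calg_scale c x + calg_scale c y" by (simp add: s)
  show "calg_scale (c + d) x = calg_scale c x + calg_scale d x" by (simp add: s)
  show "calg_scale c (calg_scale d x) = calg_scale (c * d) x" by (simp add: s)
  show "calg_scale 1 x = x" by (simp add: s)
  show "calg_mult (calg_mult x y) z = calg_mult x (calg_mult y z)" by (simp add: s)
  show "calg_mult calg_unit x = x" by (simp add: x calg_unit_def)
  show "calg_mult x calg_unit = x" by (simp add: x calg_unit_def)
  show "calg_mult (x + y) z = calg_mult x z + calg_mult y z" by (simp add: s)
  show "calg_mult x (y + z) = calg_mult x y + calg_mult x z" by (simp add: s)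
  show "calg_mult (calg_scale c x) y = calg_scale c (calg_mult x y)" by (simp add: s)
  show "calg_mult x (calg_scale c y) = calg_scale c (calg_mult x y)" by (simp add: s)
  show "calg_star (x + y) = calg_star x + calg_star y" by (simp add: s)
  show "calg_star (calg_scale c x) = calg_scale (cnj c) (calg_star x)" by (simp add: s)
  show "calg_star (calg_star x) = x" by (simp add: s)
  show "calg_star (calg_mult x y) = calg_mult (calg_star y) (calg_star x)" by (simp add: s)
qed

text \<open>\<^typ>\<open>calg\<close> is the complexification of \<^typ>\<open>alg\<close>, with the product and degree map extended
  linearly and the involution extended conjugate-linearly.\<close>

lemma complexification:
  "\<exists>!(a, a'). z = complexify a + calg_scale \<i> (complexify a')"
proof -
  obtain x y Z where z: "z = (x, y, Z)" by (cases z)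
  show ?thesis
    unfolding z
    by (rule ex1I[of _ "((Re x, Re y, map_matrix Re Z), (Im x, Im y, map_matrix Im Z))"])
      (auto simp: vec_eq_iff complex_eq_iff)
qed

lemma complexify_add: "complexify (a + a') = complexify a + complexify a'"
  by (cases a; cases a') (simp add: vec_eq_iff)

lemma complexify_scaleR: "complexify (r *\<^sub>R a) = calg_scale (of_real r) (complexify a)"
  by (cases a) (simp add: vec_eq_iff)

lemma complexify_mult: "complexify (alg_mult a a') = calg_mult (complexify a) (complexify a')"
  by (cases a; cases a') (simp add: vec_eq_iff matrix_matrix_mult_def)

lemma complexify_star: "complexify (alg_star a) = calg_star (complexify a)"
  by (cases a) (simp add: vec_eq_iff transpose_def)

lemma complexify_degree: "of_real (alg_degree a) = calg_degree (complexify a)"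
  by (cases a) simp


section \<open>The basis \<open>\<E>\<close>, transition matrices and the weighted form\<close>

definition matrix_unit :: "2 \<Rightarrow> 2 \<Rightarrow> real^2^2" where
  "matrix_unit k l = (\<chi> i j. if i = k \<and> j = l then 1 else 0)"

text \<open>The diagonal matrix units precede the off-diagonal ones.\<close>

definition basis_E :: "nat \<Rightarrow> alg" where
  "basis_E i =
     [(1, 0, 0), (0, 1, 0),
      (0, 0, matrix_unit 1 1), (0, 0, matrix_unit 2 2),
      (0, 0, matrix_unit 1 2), (0, 0, matrix_unit 2 1)] ! i"

definition transition_matrix :: "(nat \<Rightarrow> alg) \<Rightarrow> nat \<Rightarrow> nat \<Rightarrow> real" where
  "transition_matrix b i j = real_vector.representation (basis_E ` {..5}) (b j) (basis_E i)"

lemma atMost_5: "{..5::nat} = {0, 1, 2, 3, 4, 5}"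
  by auto

lemma sum_basis_E:
  "(\<Sum>i\<le>5. c i *\<^sub>R basis_E i) = (c 0, c 1, vector [vector [c 2, c 4], vector [c 5, c 3]])"
  by (simp add: atMost_5 basis_E_def matrix_unit_def vec_eq_iff forall_2)

lemma inj_basis_E: "inj_on basis_E {..5}"
  by (auto simp: inj_on_def atMost_5 basis_E_def matrix_unit_def vec_eq_iff forall_2)

lemma independent_basis_E: "independent (basis_E ` {..5})"
proof (rule independent_if_scalars_zero)
  fix f x
  assume "(\<Sum>x\<in>basis_E ` {..5}. f x *\<^sub>R x) = 0" and x: "x \<in> basis_E ` {..5}"
  then have "(\<Sum>i\<le>5. f (basis_E i) *\<^sub>R basis_E i) = 0"
    by (simp add: sum.reindex[OF inj_basis_E])
  then have "\<forall>i\<in>{..5}. f (basis_E i) = 0"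
    unfolding sum_basis_E[of "\<lambda>i. f (basis_E i)"] 
    by (simp add: atMost_5 vec_eq_iff forall_2 zero_prod_def)
  with x show "f x = 0" by auto
qed simp

lemma span_basis_E: "span (basis_E ` {..5}) = UNIV"
proof -
  have "a \<in> span (basis_E ` {..5})" for a
  proof -
    obtain x y Z where a: "a = (x, y, Z)" by (cases a)
    have "a = (\<Sum>i\<le>5. [x, y, Z$1$1, Z$2$2, Z$1$2, Z$2$1] ! i *\<^sub>R basis_E i)"
      unfolding sum_basis_E by (simp add: a vec_eq_iff forall_2)
    also have "\<dots> \<in> span (basis_E ` {..5})"
      by (intro span_sum span_scale span_base) auto
    finally show ?thesis .
  qed
  then show ?thesis by auto
qed

lemma transition_matrix: "b j = (\<Sum>i\<le>5. transition_matrix b i j *\<^sub>R basis_E i)"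
  using real_vector.sum_representation_eq[OF independent_basis_E, of "b j" "basis_E ` {..5}"]
  by (simp add: span_basis_E transition_matrix_def sum.reindex[OF inj_basis_E])

definition weighted_form :: "(nat \<Rightarrow> real) \<Rightarrow> (nat \<Rightarrow> real) \<Rightarrow> (nat \<Rightarrow> real) \<Rightarrow> real" where
  "weighted_form \<delta> u v = (\<Sum>k\<le>5. u k * v k * inverse (\<delta> k))"

end

theory Submission
  imports Defs
begin

text \<open>In a standard basis the coefficient \<open>\<tau>\<close> of \<open>b\<^sub>0\<close> is a trace with
  \<open>\<tau>(b\<^sub>j b\<^sub>k\<^sup>*) = \<delta>\<^sub>j\<close> if \<open>j = k\<close> and \<open>0\<close> otherwise. A trace on
  \<open>\<real> \<oplus> \<real> \<oplus> M\<^sub>2(\<real>)\<close> is a weighted sum of the three matrix traces, so these relations say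
  \<open>P\<^sup>T D P = diag \<delta>\<close> with \<open>D\<close> the diagonal matrix of the weights, which is equivalent to
  \<open>P (diag \<delta>)\<^sup>-\<^sup>1 P\<^sup>T = D\<^sup>-\<^sup>1\<close>, the orthogonality of the rows. The row relations of the two
  one-dimensional components and \<open>\<tau>(1) = 1\<close> identify the weights.\<close>

section \<open>Complexifying a real basis\<close>

abbreviation alg_unit :: alg where
  "alg_unit \<equiv> (1, 1, mat 1)"

lemma complexify_unit: "complexify alg_unit = calg_unit"
  by (simp add: calg_unit_def vec_eq_iff mat_def)

lemma complexify_eq_iff [simp]: "complexify a = complexify a' \<longleftrightarrow> a = a'"
  by (cases a; cases a') (auto simp: vec_eq_iff)

lemma inj_complexify: "inj_on complexify S"
  by (simp add: inj_on_def)

lemma complexify_sum: "complexify (\<Sum>x\<in>S. f x) = (\<Sum>x\<in>S. complexify (f x))"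
proof (induction S rule: infinite_finite_induct)
  case (insert x S)
  then show ?case by (simp add: complexify_add)
qed (simp_all add: zero_prod_def vec_eq_iff)

lemma complexify_parts_eq_0:
  assumes "complexify a + calg_scale \<i> (complexify a') = 0"
  shows "a = 0 \<and> a' = 0"
  using assms by (cases a; cases a') (auto simp: zero_prod_def vec_eq_iff complex_eq_iff)

lemma calg_scale_complexify:
  "calg_scale z (complexify a) = complexify (Re z *\<^sub>R a) + calg_scale \<i> (complexify (Im z *\<^sub>R a))"
  by (cases a) (simp add: vec_eq_iff complex_eq_iff)

text \<open>A complex relation among real vectors splits into one real relation for the real parts
  of the coefficients and one for the imaginary parts; both are trivial.\<close>

lemma calg_independent_complexify:
  assumes "finite S" "independent S"
  shows "calg.independent (complexify ` S)"
proof (rule calg.independent_if_scalars_zero)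
  fix f x
  assume eq: "(\<Sum>x\<in>complexify ` S. calg_scale (f x) x) = 0" and x: "x \<in> complexify ` S"
  let ?r = "\<lambda>p. \<Sum>v\<in>S. p (f (complexify v)) *\<^sub>R v"
  have "complexify (?r Re) + calg_scale \<i> (complexify (?r Im)) = 0"
    unfolding complexify_sum calg.scale_sum_right sum.distrib[symmetric]
      calg_scale_complexify[symmetric]
    using eq by (simp add: sum.reindex[OF inj_complexify])
  then have "?r Re = 0" "?r Im = 0"
    using complexify_parts_eq_0 by blast+
  then have "\<forall>v\<in>S. Re (f (complexify v)) = 0 \<and> Im (f (complexify v)) = 0"
    using real_vector.independentD[OF assms(2,1) subset_refl, of "\<lambda>v. Re (f (complexify v))"]
      real_vector.independentD[OF assms(2,1) subset_refl, of "\<lambda>v. Im (f (complexify v))"]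
    by blast
  then show "f x = 0"
    using x by (auto simp: complex_eq_iff)
qed (use assms in simp)

lemma calg_span_complexify:
  assumes "finite S" "span S = UNIV"
  shows "calg.span (complexify ` S) = UNIV"
proof -
  have c: "complexify a \<in> calg.span (complexify ` S)" for a
  proof -
    have "a \<in> span S" using assms(2) by simp
    then obtain u where "a = (\<Sum>v\<in>S. u v *\<^sub>R v)"
      using real_vector.span_finite[OF assms(1)] by auto
    then have "complexify a = (\<Sum>v\<in>S. calg_scale (of_real (u v)) (complexify v))"
      by (simp add: complexify_sum complexify_scaleR)
    then show ?thesis
      by (simp add: calg.span_sum calg.span_scale calg.span_base)
  qed
  have "z \<in> calg.span (complexify ` S)" for z
  proof -
    obtain a a' where "z = complexify a + calg_scale \<i> (complexify a')"
      using complexification[of z] by auto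
    then show ?thesis
      using c by (simp add: calg.span_add calg.span_scale)
  qed
  then show ?thesis by auto
qed

text \<open>\<open>complexify\<close> carries the real expansion of \<open>a\<close> to a complex
  expansion with the same coefficients, and coordinates are unique. In particular the structure
  constants of a complexified real basis are real.\<close>

lemma calg_representation_complexify:
  assumes S: "finite S" "independent S" "span S = UNIV" and v: "v \<in> S"
  shows "calg.representation (complexify ` S) (complexify a) (complexify v) =
    of_real (real_vector.representation S a v)"
proof -
  note indep = calg_independent_complexify[OF S(1,2)]
  note span = calg_span_complexify[OF S(1,3)]
  let ?r = "real_vector.representation S a"
  have "a = (\<Sum>w\<in>S. ?r w *\<^sub>R w)"
    using real_vector.sum_representation_eq[OF S(2) _ S(1) subset_refl, of a] S(3) by simp
  then have "complexify a = (\<Sum>w\<in>S. calg_scale (of_real (?r w)) (complexify w))"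
    by (metis (no_types, lifting) complexify_sum complexify_scaleR sum.cong)
  then have "calg.representation (complexify ` S) (complexify a) (complexify v) =
      (\<Sum>w\<in>S. of_real (?r w) * (if v = w then 1 else 0))"
    by (simp add: calg.representation_sum[OF indep] calg.representation_scale[OF indep] span
        calg.representation_basis[OF indep])
  also have "\<dots> = of_real (?r v)"
    using v S(1) by (simp add: if_distrib cong: if_cong)
  finally show ?thesis .
qed

section \<open>Standard bases in terms of real data\<close>

lemma one_dim_hom_calg_degree: "calg.one_dim_hom calg_degree"
  unfolding calg.one_dim_hom_def by (auto simp: calg_unit_def)

text \<open>Complexification preserves bases and coordinates, so reality of the structure constants
  and the homomorphism properties of the degree map hold automatically. What remains is a condition
  on \<open>S\<close> and the functional \<open>t\<close>, in which standardness turns positivity of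
  the constants at the unit into positivity of the degree.\<close>

lemma standard_complexify_iff:
  fixes S :: "alg set"
  defines "t \<equiv> \<lambda>a. real_vector.representation S a alg_unit"
  assumes S: "finite S" "independent S" "span S = UNIV"
  shows "calg.standard_RBA_delta_basis (complexify ` S) calg_degree \<longleftrightarrow>
    alg_unit \<in> S \<and> alg_star ` S = S \<and>
    (\<forall>x\<in>S. \<forall>y\<in>S. t (alg_mult x y) \<noteq> 0 \<longleftrightarrow> y = alg_star x) \<and>
    (\<forall>x\<in>S. t (alg_mult x (alg_star x)) = alg_degree x \<and>
            t (alg_mult (alg_star x) x) = alg_degree x \<and> alg_degree x > 0)"
    (is "?L \<longleftrightarrow> ?R")
proof -
  let ?C = "complexify ` S"
  have sc: "calg.struct_const ?C (complexify x) (complexify y) (complexify z) =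
      of_real (real_vector.representation S (alg_mult x y) z)" if "z \<in> S" for x y z
    unfolding calg.struct_const_def complexify_mult[symmetric]
    by (rule calg_representation_complexify[OF S that])
  have unit: "calg_unit \<in> ?C \<longleftrightarrow> alg_unit \<in> S"
    by (auto simp: complexify_unit[symmetric] simp del: complexify.simps)
  have star: "calg_star ` ?C = ?C \<longleftrightarrow> alg_star ` S = S"
  proof -
    have "calg_star ` ?C = complexify ` alg_star ` S"
      by (simp add: image_image complexify_star)
    then show ?thesis
      by (simp add: inj_image_eq_iff[OF inj_complexify])
  qed
  have t: "calg.struct_const ?C (complexify x) (complexify y) calg_unit =
      of_real (t (alg_mult x y))" if "alg_unit \<in> S" for x y
    using sc[OF that] by (simp add: t_def complexify_unit[symmetric] del: complexify.simps)
  have deg: "calg_degree (calg_star z) = cnj (calg_degree z)" for z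
    by (cases z) simp
  show ?thesis
  \<comment> \<open>The transfer of coefficients to \<open>t\<close> applies when the unit is a
    basis element; otherwise both sides are false.\<close>
  proof (cases "alg_unit \<in> S")
    case True
    show ?thesis
      unfolding calg.standard_RBA_delta_basis_def calg.RBA_delta_basis_def calg.RBA_basis_def
        unit star
      using S(1) calg_independent_complexify[OF S(1,2)] calg_span_complexify[OF S(1,3)]
        one_dim_hom_calg_degree deg
      by (simp add: sc t[OF True] True complexify_star[symmetric] complexify_degree[symmetric]
          del: calg_star.simps calg_degree.simps alg_star.simps alg_mult.simps split_paired_All)
        (auto simp del: alg_star.simps alg_mult.simps alg_degree.simps)
  next
    case False
    then show ?thesis
      by (simp add: calg.standard_RBA_delta_basis_def calg.RBA_delta_basis_def
          calg.RBA_basis_def unit)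
  qed
qed


section \<open>Coordinates with respect to an enumerated basis\<close>

locale alg_basis =
  fixes c :: "nat \<Rightarrow> alg"
  assumes inj: "inj_on c {..5}"
    and indep: "independent (c ` {..5})"
    and span: "span (c ` {..5}) = UNIV"
begin

text \<open>Coordinates are addressed by index, which injectivity of \<open>c\<close> makes
  unambiguous. When \<open>c 0\<close> is the unit, \<open>coeff 0\<close> is the functional
  \<tau>.\<close>

definition coeff :: "nat \<Rightarrow> alg \<Rightarrow> real" where
  "coeff k a = real_vector.representation (c ` {..5}) a (c k)"

lemma linear_coeff: "linear (coeff k)"
  by (rule linearI)
    (simp_all add: coeff_def real_vector.representation_add[OF indep]
      real_vector.representation_scale[OF indep] span)

lemma expansion: "(\<Sum>k\<le>5. coeff k a *\<^sub>R c k) = a"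
  using real_vector.sum_representation_eq[OF indep, of a "c ` {..5}"]
  by (simp add: span coeff_def sum.reindex[OF inj])

lemma coeff_basis:
  assumes "j \<le> 5" "k \<le> 5"
  shows "coeff k (c j) = (if j = k then 1 else 0)"
  using assms inj
  by (auto simp: coeff_def real_vector.representation_basis[OF indep] inj_on_eq_iff)

lemma linear_expansion:
  assumes "linear f"
  shows "f a = (\<Sum>k\<le>5. coeff k a *\<^sub>R f (c k))"
  using expansion[of a] linear_sum[OF assms, of "\<lambda>k. coeff k a *\<^sub>R c k" "{..5}"]
  by (simp add: linear_cmul[OF assms])

lemma coeff_sum:
  assumes "k \<le> 5"
  shows "coeff k (\<Sum>j\<le>5. r j *\<^sub>R c j) = r k"
proof -
  have "coeff k (\<Sum>j\<le>5. r j *\<^sub>R c j) = (\<Sum>j\<le>5. r j * (if j = k then 1 else 0))"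
    using assms by (simp add: linear_sum[OF linear_coeff] linear_cmul[OF linear_coeff] coeff_basis)
  also have "\<dots> = r k"
    using assms by (simp add: if_distrib cong: if_cong)
  finally show ?thesis .
qed

lemma eq_if_coeff_eq:
  assumes "\<And>k. k \<le> 5 \<Longrightarrow> coeff k a = coeff k a'"
  shows "a = a'"
proof -
  have "(\<Sum>k\<le>5. coeff k a *\<^sub>R c k) = (\<Sum>k\<le>5. coeff k a' *\<^sub>R c k)"
    using assms by (intro sum.cong) auto
  then show ?thesis
    by (simp only: expansion)
qed

lemma linear_eqI:
  assumes "linear f" "linear g" "\<And>k. k \<le> 5 \<Longrightarrow> f (c k) = g (c k)"
  shows "f = g"
proof
  fix a
  have "(\<Sum>k\<le>5. coeff k a *\<^sub>R f (c k)) = (\<Sum>k\<le>5. coeff k a *\<^sub>R g (c k))"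
    using assms(3) by (intro sum.cong) auto
  then show "f a = g a"
    by (simp only: linear_expansion[OF assms(1), symmetric] linear_expansion[OF assms(2), symmetric])
qed

end

section \<open>Coordinates with respect to \<open>basis_E\<close>\<close>

interpretation E: alg_basis basis_E
  by unfold_locales (rule inj_basis_E independent_basis_E span_basis_E)+

lemma transition_matrix_eq_coeff: "transition_matrix c i j = E.coeff i (c j)"
  by (simp add: transition_matrix_def E.coeff_def)

lemma E_coeff:
  assumes "i \<le> 5"
  shows "E.coeff i (x, y, Z) = [x, y, Z$1$1, Z$2$2, Z$1$2, Z$2$1] ! i"
proof -
  have "(x, y, Z) = (\<Sum>i\<le>5. [x, y, Z$1$1, Z$2$2, Z$1$2, Z$2$1] ! i *\<^sub>R basis_E i)"
    unfolding sum_basis_E by (simp add: vec_eq_iff forall_2)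
  then show ?thesis
    by (simp only: E.coeff_sum[OF assms])
qed

text \<open>If \<open>P\<close> is the transition matrix, \<open>D\<close> and \<open>W\<close> are diagonal, then \<open>P\<^sup>T D P = W\<close> and
  \<open>D P W\<^sup>-\<^sup>1 P\<^sup>T = 1\<close> both say that the inverse of \<open>P\<close> is \<open>W\<^sup>-\<^sup>1 P\<^sup>T D\<close>.\<close>

lemma (in alg_basis) gram_iff_dual:
  fixes D w :: "nat \<Rightarrow> real"
  assumes w: "\<And>k. k \<le> 5 \<Longrightarrow> w k \<noteq> 0"
  shows "(\<forall>j\<le>5. \<forall>k\<le>5. (\<Sum>i\<le>5. D i * E.coeff i (c j) * E.coeff i (c k)) = (if j = k then w k else 0))
    \<longleftrightarrow> (\<forall>i\<le>5. \<forall>j\<le>5. D i * (\<Sum>k\<le>5. E.coeff i (c k) * E.coeff j (c k) / w k) =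
          (if i = j then 1 else 0))"
    (is "?gram \<longleftrightarrow> ?dual")
proof -
  \<comment> \<open>\<open>coeff k (basis_E i)\<close> is the entry (k, i) of the inverse of P, so
    \<open>inv\<close> is the matrix equation to which both sides reduce.\<close>
  define inv where "inv \<longleftrightarrow>
    (\<forall>i\<le>5. \<forall>k\<le>5. coeff k (basis_E i) = D i * E.coeff i (c k) / w k)"
  have "?gram \<longleftrightarrow> inv"
  proof
    assume gram: ?gram
    have "D i * E.coeff i (c k) = coeff k (basis_E i) * w k" if ik: "i \<le> 5" "k \<le> 5" for i k
    proof -
      \<comment> \<open>The Gram form with \<open>c k\<close> fixed in its second argument. At
        \<open>basis_E i\<close> it is computed twice: directly, and through the expansion of
        \<open>basis_E i\<close> in \<open>c\<close>.\<close>
      let ?q = "\<lambda>a. \<Sum>i\<le>5. D i * E.coeff i a * E.coeff i (c k)"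
      have "linear ?q"
        by (rule linearI)
          (simp_all add: linear_add[OF E.linear_coeff] linear_cmul[OF E.linear_coeff]
            algebra_simps sum.distrib sum_distrib_left)
      then have "?q (basis_E i) = (\<Sum>j\<le>5. coeff j (basis_E i) * ?q (c j))"
        using linear_expansion[of ?q "basis_E i"] by simp
      also have "\<dots> = (\<Sum>j\<le>5. if j = k then coeff j (basis_E i) * w k else 0)"
        using gram ik by (intro sum.cong) auto
      also have "\<dots> = coeff k (basis_E i) * w k"
        using ik by simp
      finally show ?thesis
        using ik by (simp add: E.coeff_basis if_distrib if_distribR cong: if_cong)
    qed
    then show inv
      using w by (simp add: inv_def)
  next
    assume inv: inv
    show ?gram
    proof (intro allI impI)
      fix j k :: nat
      assume jk: "j \<le> 5" "k \<le> 5"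
      have "(\<Sum>i\<le>5. D i * E.coeff i (c j) * E.coeff i (c k)) =
          w k * (\<Sum>i\<le>5. E.coeff i (c j) * coeff k (basis_E i))"
        unfolding sum_distrib_left using inv w jk
        by (intro sum.cong) (auto simp: inv_def)
      also have "(\<Sum>i\<le>5. E.coeff i (c j) * coeff k (basis_E i)) = coeff k (c j)"
        using E.linear_expansion[OF linear_coeff, of k "c j"] by simp
      finally show "(\<Sum>i\<le>5. D i * E.coeff i (c j) * E.coeff i (c k)) = (if j = k then w k else 0)"
        using jk by (simp add: coeff_basis)
    qed
  qed
  also have "inv \<longleftrightarrow> ?dual"
  proof
    assume inv: inv
    show ?dual
    proof (intro allI impI)
      fix i j :: nat
      assume ij: "i \<le> 5" "j \<le> 5"
      have "D i * (\<Sum>k\<le>5. E.coeff i (c k) * E.coeff j (c k) / w k) =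
          (\<Sum>k\<le>5. coeff k (basis_E i) * E.coeff j (c k))"
        unfolding sum_distrib_left using inv ij by (intro sum.cong) (auto simp: inv_def)
      also have "\<dots> = E.coeff j (basis_E i)"
        using linear_expansion[OF E.linear_coeff, of j "basis_E i"] by simp
      finally show "D i * (\<Sum>k\<le>5. E.coeff i (c k) * E.coeff j (c k) / w k) = (if i = j then 1 else 0)"
        using ij by (simp add: E.coeff_basis)
    qed
  next
    assume dual: ?dual
    \<comment> \<open>By the dual relations the proposed combination of the \<open>c k\<close> has
      the \<open>E\<close>-coordinates of \<open>basis_E i\<close>; uniqueness of coordinates in
      \<open>c\<close> then identifies the inverse of P.\<close>
    have e: "(\<Sum>k\<le>5. (D i * E.coeff i (c k) / w k) *\<^sub>R c k) = basis_E i" if i: "i \<le> 5" for i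
    proof (rule E.eq_if_coeff_eq)
      fix j :: nat
      assume j: "j \<le> 5"
      have "E.coeff j (\<Sum>k\<le>5. (D i * E.coeff i (c k) / w k) *\<^sub>R c k) =
          D i * (\<Sum>k\<le>5. E.coeff i (c k) * E.coeff j (c k) / w k)"
        by (simp add: linear_sum[OF E.linear_coeff] linear_cmul[OF E.linear_coeff]
            sum_distrib_left mult.assoc)
      then show "E.coeff j (\<Sum>k\<le>5. (D i * E.coeff i (c k) / w k) *\<^sub>R c k) = E.coeff j (basis_E i)"
        using dual i j by (simp add: E.coeff_basis)
    qed
    show inv
      unfolding inv_def
    proof (intro allI impI)
      fix i k :: nat
      assume "i \<le> 5" "k \<le> 5"
      then show "coeff k (basis_E i) = D i * E.coeff i (c k) / w k"
        by (simp only: e[symmetric] coeff_sum)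
    qed
  qed
  finally show ?thesis .
qed


section \<open>Traces\<close>

fun wtrace :: "real \<Rightarrow> real \<Rightarrow> real \<Rightarrow> alg \<Rightarrow> real" where
  "wtrace \<alpha> \<beta> \<gamma> (x, y, Z) = \<alpha> * x + \<beta> * y + \<gamma> * (Z$1$1 + Z$2$2)"

abbreviation (input) wdiag :: "real \<Rightarrow> real \<Rightarrow> real \<Rightarrow> nat \<Rightarrow> real" where
  "wdiag \<alpha> \<beta> \<gamma> i \<equiv> if i = 0 then \<alpha> else if i = 1 then \<beta> else \<gamma>"

lemma linear_wtrace: "linear (wtrace \<alpha> \<beta> \<gamma>)"
proof (rule linearI)
  fix a a' :: alg and r :: real
  show "wtrace \<alpha> \<beta> \<gamma> (a + a') = wtrace \<alpha> \<beta> \<gamma> a + wtrace \<alpha> \<beta> \<gamma> a'"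
    by (cases a; cases a') (simp add: algebra_simps)
  show "wtrace \<alpha> \<beta> \<gamma> (r *\<^sub>R a) = r *\<^sub>R wtrace \<alpha> \<beta> \<gamma> a"
    by (cases a) (simp add: algebra_simps)
qed

text \<open>The trace of a matrix times the transpose of another is their entrywise inner product,
  so \<open>basis_E\<close> is orthogonal for this form and all four matrix units carry the weight
  \<gamma>.\<close>

lemma wtrace_mult_star:
  "wtrace \<alpha> \<beta> \<gamma> (alg_mult a (alg_star a')) =
    (\<Sum>i\<le>5. wdiag \<alpha> \<beta> \<gamma> i * E.coeff i a * E.coeff i a')"
  by (cases a; cases a')
    (simp add: atMost_5 E_coeff matrix_matrix_mult_def transpose_def sum_2 algebra_simps)

text \<open>Since E12 = E11 E12 and E12 E11 = 0, commutation forces the value 0 on E12, and likewise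
  on E21. From E11 = E12 E21 and E22 = E21 E12 the two diagonal units get equal values.\<close>

lemma trace_eq_wtrace:
  assumes lin: "linear t" and comm: "\<And>a a'. t (alg_mult a a') = t (alg_mult a' a)"
  shows "t = wtrace (t (basis_E 0)) (t (basis_E 1)) (t (basis_E 2))"
proof (rule E.linear_eqI[OF lin linear_wtrace])
  note m = basis_E_def matrix_unit_def vec_eq_iff matrix_matrix_mult_def sum_2 forall_2
  have "basis_E 4 = alg_mult (basis_E 2) (basis_E 4)" "0 = alg_mult (basis_E 4) (basis_E 2)"
    "basis_E 5 = alg_mult (basis_E 3) (basis_E 5)" "0 = alg_mult (basis_E 5) (basis_E 3)"
    "basis_E 2 = alg_mult (basis_E 4) (basis_E 5)" "basis_E 3 = alg_mult (basis_E 5) (basis_E 4)"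
    by (simp_all add: m zero_prod_def)
  then have "t (basis_E 4) = 0" "t (basis_E 5) = 0" "t (basis_E 3) = t (basis_E 2)"
    using comm linear_0[OF lin] by metis+
  moreover fix k :: nat
  assume "k \<le> 5"
  then have "k \<in> {0, 1, 2, 3, 4, 5}" by auto
  ultimately show "t (basis_E k) = wtrace (t (basis_E 0)) (t (basis_E 1)) (t (basis_E 2)) (basis_E k)"
    by (auto simp: basis_E_def matrix_unit_def)
qed


section \<open>Standard bases and the orthogonality relations\<close>

lemma alg_star_star [simp]: "alg_star (alg_star a) = a"
  by (cases a) simp

lemma alg_star_unit: "alg_star alg_unit = alg_unit"
  by simp

lemma alg_mult_unit: "alg_mult a alg_unit = a"
  by (cases a) simp

lemma alg_degree_star [simp]: "alg_degree (alg_star a) = alg_degree a"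
  by (cases a) simp

lemma linear_alg_star: "linear alg_star"
proof (rule linearI)
  fix a a' :: alg and r :: real
  show "alg_star (a + a') = alg_star a + alg_star a'"
    by (cases a; cases a') (simp add: transpose_def vec_eq_iff)
  show "alg_star (r *\<^sub>R a) = r *\<^sub>R alg_star a"
    by (cases a) (simp add: transpose_def vec_eq_iff)
qed

lemma linear_alg_mult_left: "linear (\<lambda>a. alg_mult a a')"
proof (rule linearI)
  fix x y :: alg and r :: real
  show "alg_mult (x + y) a' = alg_mult x a' + alg_mult y a'"
    by (cases x; cases y; cases a') (simp add: matrix_matrix_mult_def vec_eq_iff sum_2 algebra_simps)
  show "alg_mult (r *\<^sub>R x) a' = r *\<^sub>R alg_mult x a'"
    by (cases x; cases a') (simp add: matrix_matrix_mult_def vec_eq_iff sum_2 algebra_simps)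
qed

lemma linear_alg_mult_right: "linear (\<lambda>a'. alg_mult a a')"
proof (rule linearI)
  fix x y :: alg and r :: real
  show "alg_mult a (x + y) = alg_mult a x + alg_mult a y"
    by (cases x; cases y; cases a) (simp add: matrix_matrix_mult_def vec_eq_iff sum_2 algebra_simps)
  show "alg_mult a (r *\<^sub>R x) = r *\<^sub>R alg_mult a x"
    by (cases x; cases a) (simp add: matrix_matrix_mult_def vec_eq_iff sum_2 algebra_simps)
qed

text \<open>The involution permutes \<open>S\<close>, so y may be replaced by its image. The
  conditions on products then become orthogonality for the form
  \<open>t (alg_mult x (alg_star y))\<close>, with the degrees as squared lengths; positive degrees
  give the non-vanishing.\<close>

lemma gram_iff_RBA_trace:
  assumes star: "alg_star ` S = S"
  shows "(\<forall>x\<in>S. \<forall>y\<in>S. t (alg_mult x y) \<noteq> 0 \<longleftrightarrow> y = alg_star x) \<and>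
      (\<forall>x\<in>S. t (alg_mult x (alg_star x)) = alg_degree x \<and>
              t (alg_mult (alg_star x) x) = alg_degree x \<and> alg_degree x > 0)
    \<longleftrightarrow> (\<forall>x\<in>S. alg_degree x > 0) \<and>
      (\<forall>x\<in>S. \<forall>y\<in>S. t (alg_mult x (alg_star y)) = (if x = y then alg_degree x else (0::real)))"
    (is "?L \<longleftrightarrow> ?R")
proof
  have S: "alg_star x \<in> S" if "x \<in> S" for x
    using star that by blast
  assume L: ?L
  have "t (alg_mult x (alg_star y)) = (if x = y then alg_degree x else 0)"
    if xy: "x \<in> S" "y \<in> S" for x y
  proof (cases "x = y")
    case False
    then have "alg_star y \<noteq> alg_star x"
      by (metis alg_star_star)
    then show ?thesis
      using L xy S False by metis
  qed (use L xy in simp)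
  then show ?R
    using L by blast
next
  have S: "alg_star x \<in> S" if "x \<in> S" for x
    using star that by blast
  assume R: ?R
  have g: "t (alg_mult x y) = (if x = alg_star y then alg_degree x else 0)"
    if xy: "x \<in> S" "y \<in> S" for x y
    using R S[OF xy(2)] xy(1) alg_star_star[of y] by metis
  show ?L
  proof (intro conjI ballI)
    fix x y
    assume xy: "x \<in> S" "y \<in> S"
    have "x = alg_star y \<longleftrightarrow> y = alg_star x"
      by (metis alg_star_star)
    then show "t (alg_mult x y) \<noteq> 0 \<longleftrightarrow> y = alg_star x"
      using g[OF xy] R xy by (metis less_irrefl)
  next
    fix x
    assume x: "x \<in> S"
    show "t (alg_mult x (alg_star x)) = alg_degree x"
      "t (alg_mult (alg_star x) x) = alg_degree x" "alg_degree x > 0"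
      using g[OF x S[OF x]] g[OF S[OF x] x] R x by simp_all
  qed
qed

text \<open>For basis elements x and y the value at their product is the degree of x if x is the
  star of y, and 0 otherwise. This is symmetric because the involution has order two and preserves
  the degree; linearity in each argument extends it to all elements.\<close>

lemma (in alg_basis) coeff_trace_commute:
  assumes star: "alg_star ` c ` {..5} = c ` {..5}"
    and gram: "\<And>x y. x \<in> c ` {..5} \<Longrightarrow> y \<in> c ` {..5} \<Longrightarrow>
      coeff 0 (alg_mult x (alg_star y)) = (if x = y then alg_degree x else 0)"
  shows "coeff 0 (alg_mult a a') = coeff 0 (alg_mult a' a)"
proof -
  have basis: "coeff 0 (alg_mult x y) = coeff 0 (alg_mult y x)"
    if xy: "x \<in> c ` {..5}" "y \<in> c ` {..5}" for x y
  proof -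
    have s: "alg_star x \<in> c ` {..5}" "alg_star y \<in> c ` {..5}"
      using star xy by blast+
    have "x = alg_star y \<longleftrightarrow> y = alg_star x"
      by (metis alg_star_star)
    then show ?thesis
      using gram[OF xy(1) s(2)] gram[OF xy(2) s(1)] by auto
  qed
  have left: "coeff 0 (alg_mult x a') = coeff 0 (alg_mult a' x)" if x: "x \<in> c ` {..5}" for x a'
  proof -
    have "(\<lambda>a'. coeff 0 (alg_mult x a')) = (\<lambda>a'. coeff 0 (alg_mult a' x))"
      using linear_compose[OF linear_alg_mult_right[of x] linear_coeff[of 0]]
        linear_compose[OF linear_alg_mult_left[of x] linear_coeff[of 0]] basis[OF x]
      by (intro linear_eqI) (auto simp: o_def)
    then show ?thesis by (rule fun_cong)
  qed
  have "(\<lambda>a. coeff 0 (alg_mult a a')) = (\<lambda>a. coeff 0 (alg_mult a' a))"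
    using linear_compose[OF linear_alg_mult_right[of a'] linear_coeff[of 0]]
      linear_compose[OF linear_alg_mult_left[of a'] linear_coeff[of 0]] left[of _ a']
    by (intro linear_eqI) (auto simp: o_def)
  then show ?thesis by (rule fun_cong)
qed

text \<open>The coefficient of \<open>b\<^sub>0\<close> is the trace with weights \<open>1/n\<close>, \<open>m\<^sub>\<phi>/n\<close>, \<open>m\<^sub>\<chi>/n\<close>.\<close>

lemma (in alg_basis) standard_iff_orthogonality:
  fixes \<delta> \<phi> :: "nat \<Rightarrow> real" and B :: "nat \<Rightarrow> real^2^2"
  defines "n \<equiv> (\<Sum>i\<le>5. \<delta> i)"
  defines "m_phi \<equiv> n / (\<Sum>i\<le>5. (\<phi> i)\<^sup>2 / \<delta> i)"
  defines "m_chi \<equiv> (n - 1 - m_phi) / 2"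
  defines "m \<equiv> (\<lambda>i::nat. if i = 0 then 1 else if i = 1 then m_phi else m_chi)"
  assumes c: "\<And>i. i \<le> 5 \<Longrightarrow> c i = (\<delta> i, \<phi> i, B i)"
    and c0: "c 0 = alg_unit" and star: "alg_star ` c ` {..5} = c ` {..5}"
  shows "calg.standard_RBA_delta_basis (complexify ` c ` {..5}) calg_degree \<longleftrightarrow>
    (\<forall>i\<le>5. \<delta> i > 0) \<and> m_chi > 0 \<and>
    (\<forall>i\<le>5. \<forall>j\<le>5. weighted_form \<delta> (transition_matrix c i) (transition_matrix c j) =
      n / m i * (if i = j then 1 else 0))"
proof -
  \<comment> \<open>\<open>W\<close> is P (diag \<delta>)^-1 P^T. The functional is a parameter of
    \<open>gram\<close> because both \<open>coeff 0\<close> and weighted traces are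
    inserted.\<close>
  define W where "W i j = (\<Sum>k\<le>5. E.coeff i (c k) * E.coeff j (c k) / \<delta> k)" for i j
  define gram where "gram t \<longleftrightarrow>
    (\<forall>j\<le>5. \<forall>k\<le>5. t (alg_mult (c j) (alg_star (c k))) = (if j = k then \<delta> k else 0))"
    for t :: "alg \<Rightarrow> real"
  have W: "weighted_form \<delta> (transition_matrix c i) (transition_matrix c j) = W i j" for i j
    by (simp add: weighted_form_def W_def transition_matrix_eq_coeff divide_inverse)
  have \<delta>0: "\<delta> 0 = 1" and \<phi>0: "\<phi> 0 = 1"
    using c[of 0] c0 by auto
  have deg: "alg_degree (c k) = \<delta> k" "E.coeff 0 (c k) = \<delta> k" "E.coeff 1 (c k) = \<phi> k"
    if "k \<le> 5" for k
    using c[OF that] by (simp_all add: E_coeff)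
  have unit: "alg_unit \<in> c ` {..5}"
    using c0 by (metis atMost_iff imageI zero_le)
  have "calg.standard_RBA_delta_basis (complexify ` c ` {..5}) calg_degree \<longleftrightarrow>
    (\<forall>x\<in>c ` {..5}. alg_degree x > 0) \<and> (\<forall>x\<in>c ` {..5}. \<forall>y\<in>c ` {..5}.
      coeff 0 (alg_mult x (alg_star y)) = (if x = y then alg_degree x else 0))"
    using standard_complexify_iff[OF finite_imageI[OF finite_atMost] indep span]
      gram_iff_RBA_trace[OF star, of "coeff 0"] unit star
    by (simp add: coeff_def c0)
  also have "\<dots> \<longleftrightarrow> (\<forall>i\<le>5. \<delta> i > 0) \<and> gram (coeff 0)"
    using inj by (auto simp: gram_def deg inj_on_eq_iff)
  also have "\<dots> \<longleftrightarrow> (\<forall>i\<le>5. \<delta> i > 0) \<and> m_chi > 0 \<and>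
      (\<forall>i\<le>5. \<forall>j\<le>5. W i j = n / m i * (if i = j then 1 else 0))"
  proof (rule conj_cong[OF refl])
    assume pos: "\<forall>i\<le>5. \<delta> i > 0"
    \<comment> \<open>For a weighted trace the Gram relations amount to D W = 1, by the duality
      above.\<close>
    have gram_W: "gram (wtrace \<alpha> \<beta> \<gamma>) \<longleftrightarrow>
        (\<forall>i\<le>5. \<forall>j\<le>5. wdiag \<alpha> \<beta> \<gamma> i * W i j = (if i = j then 1 else 0))" for \<alpha> \<beta> \<gamma>
      unfolding gram_def wtrace_mult_star W_def
      using pos by (intro gram_iff_dual) fastforce
    have n: "n > 0"
      unfolding n_def using pos by (intro sum_pos) auto
    have W00: "W 0 0 = n"
      unfolding W_def n_def using pos
      by (intro sum.cong) (auto simp: deg[simplified])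
    have W11: "W 1 1 = (\<Sum>i\<le>5. (\<phi> i)\<^sup>2 / \<delta> i)"
      unfolding W_def by (intro sum.cong) (simp_all add: deg[simplified] power2_eq_square)
    \<comment> \<open>The term of the unit equals 1, so the denominator of \<open>m_phi\<close> is
      positive.\<close>
    have "(\<phi> 0)\<^sup>2 / \<delta> 0 \<le> (\<Sum>i\<le>5. (\<phi> i)\<^sup>2 / \<delta> i)"
      using pos by (intro member_le_sum) (auto simp: less_imp_le)
    then have W11_pos: "W 1 1 > 0"
      unfolding W11 by (simp add: \<delta>0 \<phi>0)
    have m_phi: "m_phi = n / W 1 1"
      by (simp only: m_phi_def W11)
    show "gram (coeff 0) \<longleftrightarrow> m_chi > 0 \<and>
      (\<forall>i\<le>5. \<forall>j\<le>5. W i j = n / m i * (if i = j then 1 else 0))"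
    proof
      assume g: "gram (coeff 0)"
      have "coeff 0 (alg_mult x (alg_star y)) = (if x = y then alg_degree x else 0)"
        if "x \<in> c ` {..5}" "y \<in> c ` {..5}" for x y
        using that g inj by (auto simp: gram_def deg inj_on_eq_iff)
      then obtain \<alpha> \<beta> \<gamma> where t: "coeff 0 = wtrace \<alpha> \<beta> \<gamma>"
        using trace_eq_wtrace[OF linear_coeff coeff_trace_commute[OF star]] by blast
      then have D: "wdiag \<alpha> \<beta> \<gamma> i * W i j = (if i = j then 1 else 0)" if "i \<le> 5" "j \<le> 5" for i j
        using g that by (simp add: gram_W)
      \<comment> \<open>The diagonal entries of D W = 1 at 0 and 1 fix the first two
        weights.\<close>
      have \<alpha>: "\<alpha> = 1 / n"
        using D[of 0 0] n by (simp add: W00 field_simps)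
      have \<beta>: "\<beta> = m_phi / n"
        using D[of 1 1] n W11_pos by (simp add: m_phi field_simps)
      \<comment> \<open>The coefficient functional is 1 at the unit, whose weighted trace is this
        sum; that determines the third weight.\<close>
      have "\<alpha> + \<beta> + 2 * \<gamma> = 1"
        using coeff_basis[of 0 0] by (simp add: t c0 mat_def)
      then have \<gamma>: "\<gamma> = m_chi / n"
        using n by (simp add: m_chi_def \<alpha> \<beta> field_simps)
      \<comment> \<open>Since \<open>W 2 2\<close> is a sum of squares over positive numbers, its
        product with \<gamma> can only be 1 if \<gamma> is positive.\<close>
      have "W 2 2 \<ge> 0"
        unfolding W_def using pos by (intro sum_nonneg) (simp add: less_imp_le)
      moreover have "\<gamma> * W 2 2 = 1"
        using D[of 2 2] by simp
      ultimately have "\<gamma> > 0"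
        by (metis less_eq_real_def mult_not_zero zero_less_mult_pos2 zero_less_one)
      then have m_chi: "m_chi > 0"
        using n by (simp add: \<gamma> zero_less_divide_iff)
      have Dm: "wdiag \<alpha> \<beta> \<gamma> i = m i / n" for i
        by (simp add: m_def \<alpha> \<beta> \<gamma>)
      have "m i > 0" for i
        using m_chi n W11_pos by (simp add: m_def m_phi)
      then have "W i j = n / m i * (if i = j then 1 else 0)" if "i \<le> 5" "j \<le> 5" for i j
        using D[OF that] n unfolding Dm by (simp add: field_simps less_imp_neq[symmetric] split: if_splits)
      then show "m_chi > 0 \<and> (\<forall>i\<le>5. \<forall>j\<le>5. W i j = n / m i * (if i = j then 1 else 0))"
        using m_chi by blast
    next
      assume R: "m_chi > 0 \<and> (\<forall>i\<le>5. \<forall>j\<le>5. W i j = n / m i * (if i = j then 1 else 0))"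
      \<comment> \<open>The weights derived in the forward direction now define a trace, and the row
        relations give it the Gram relations.\<close>
      let ?t = "wtrace (1 / n) (m_phi / n) (m_chi / n)"
      have Dm: "wdiag (1 / n) (m_phi / n) (m_chi / n) i = m i / n" for i
        by (simp add: m_def)
      have m: "m i > 0" for i
        using conjunct1[OF R] n W11_pos by (simp add: m_def m_phi)
      have g: "gram ?t"
        unfolding gram_W Dm
      proof (intro allI impI)
        fix i j :: nat
        assume "i \<le> 5" "j \<le> 5"
        then have "W i j = n / m i * (if i = j then 1 else 0)"
          using R by blast
        then show "m i / n * W i j = (if i = j then 1 else 0)"
          using n m[of i] by simp
      qed
      \<comment> \<open>Pairing with \<open>c 0\<close>, the unit, in the Gram relations shows that
        \<open>?t\<close> is 1 at \<open>c 0\<close> and 0 at the other basis elements.\<close>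
      have "coeff 0 = ?t"
      proof (rule linear_eqI[OF linear_coeff linear_wtrace])
        fix k :: nat
        assume k: "k \<le> 5"
        have "alg_mult (c k) (alg_star (c 0)) = c k"
          unfolding c0 alg_star_unit by (rule alg_mult_unit)
        then have "?t (c k) = (if k = 0 then \<delta> 0 else 0)"
          using g k unfolding gram_def by (metis zero_le)
        then show "coeff 0 (c k) = ?t (c k)"
          using k by (simp add: coeff_basis \<delta>0)
      qed
      then show "gram (coeff 0)"
        using g by simp
    qed
  qed
  finally show ?thesis
    by (simp add: W)
qed


section \<open>Numbering the basis\<close>

text \<open>Values are corrected one at a time: composing with the transposition of
  \<open>\<sigma> a\<close> and \<open>f a\<close> repairs the value at \<open>a\<close>, and
  injectivity of \<sigma> and \<open>f\<close> keeps the earlier values away from these two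
  points.\<close>

lemma permutes_extend:
  assumes "finite A" "A \<subseteq> S" "inj_on f A" "f ` A \<subseteq> S"
  shows "\<exists>\<sigma>. \<sigma> permutes S \<and> (\<forall>x\<in>A. \<sigma> x = f x)"
  using assms
proof (induction A rule: finite_induct)
  case empty
  then show ?case using permutes_id by blast
next
  case (insert a A)
  then obtain \<sigma> where \<sigma>: "\<sigma> permutes S" "\<forall>x\<in>A. \<sigma> x = f x"
    by auto
  let ?\<tau> = "Transposition.transpose (\<sigma> a) (f a)"
  have "f a \<in> S" "\<sigma> a \<in> S"
    using insert.prems \<sigma>(1) by (auto simp: permutes_in_image)
  then have "?\<tau> \<circ> \<sigma> permutes S"
    using \<sigma>(1) by (intro permutes_compose permutes_swap_id)
  moreover have "(?\<tau> \<circ> \<sigma>) x = f x" if x: "x \<in> insert a A" for x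
  proof (cases "x = a")
    case False
    then have "x \<in> A" using x by simp
    moreover have "\<sigma> x \<noteq> \<sigma> a"
      using permutes_inj[OF \<sigma>(1)] False by (simp add: inj_eq)
    moreover have "f x \<noteq> f a"
      using insert.prems(2) insert.hyps(2) \<open>x \<in> A\<close> by (auto simp: image_iff)
    ultimately show ?thesis
      using \<sigma>(2) by (simp add: transpose_apply_other)
  qed simp
  ultimately show ?case by blast
qed

text \<open>The skew-symmetric elements form a line, so the involution swaps exactly one pair.\<close>

lemma (in alg_basis) star_closed_numbering:
  assumes unit: "alg_unit \<in> c ` {..5}" and star: "alg_star ` c ` {..5} = c ` {..5}"
  obtains \<sigma> where "\<sigma> permutes {..5}" "c (\<sigma> 0) = alg_unit" "alg_star (c (\<sigma> 4)) = c (\<sigma> 5)"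
    "\<And>i. i \<in> {1, 2, 3} \<Longrightarrow> alg_star (c (\<sigma> i)) = c (\<sigma> i)"
proof -
  obtain i0 where i0: "i0 \<le> 5" "c i0 = alg_unit"
    using unit by auto
  have ex: "\<exists>k\<le>5. alg_star (c i) = c k" if "i \<le> 5" for i
  proof -
    have "alg_star (c i) \<in> c ` {..5}"
      using star that by blast
    then show ?thesis by auto
  qed
  have skew: "\<exists>r. a - alg_star a = r *\<^sub>R (basis_E 4 - basis_E 5)" for a
  proof -
    obtain x y Z where a: "a = (x, y, Z)" by (cases a)
    have "a - alg_star a = (Z$1$2 - Z$2$1) *\<^sub>R (basis_E 4 - basis_E 5)"
      by (simp add: a basis_E_def matrix_unit_def transpose_def vec_eq_iff forall_2)
    then show ?thesis by blast
  qed
  \<comment> \<open>Otherwise the involution would be the identity by linearity, yet it moves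
    E12.\<close>
  have "\<exists>i\<le>5. alg_star (c i) \<noteq> c i"
  proof (rule ccontr)
    assume "\<not> ?thesis"
    then have "alg_star = id"
      by (intro linear_eqI linear_alg_star real_vector.linear_id) auto
    then have "alg_star (basis_E 4) = basis_E 4"
      by simp
    then show False
      by (simp add: basis_E_def matrix_unit_def transpose_def vec_eq_iff forall_2)
  qed
  then obtain i4 where i4: "i4 \<le> 5" "alg_star (c i4) \<noteq> c i4"
    by blast
  obtain i5 where i5: "i5 \<le> 5" "alg_star (c i4) = c i5"
    using ex[OF i4(1)] by blast
  have i54: "alg_star (c i5) = c i4"
    by (metis alg_star_star i5(2))
  have fixed: "alg_star (c i) = c i" if i: "i \<le> 5" "i \<noteq> i4" "i \<noteq> i5" for i
  proof (rule ccontr)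
    assume ne: "alg_star (c i) \<noteq> c i"
    obtain k where k: "k \<le> 5" "alg_star (c i) = c k"
      using ex[OF i(1)] by blast
    obtain r where r: "c i - c k = r *\<^sub>R (basis_E 4 - basis_E 5)"
      using skew[of "c i"] k(2) by auto
    obtain s where s: "c i4 - c i5 = s *\<^sub>R (basis_E 4 - basis_E 5)"
      using skew[of "c i4"] i5(2) by auto
    \<comment> \<open>Both differences lie on the skew line. Comparing \<open>coeff i\<close>, the
      left side gives s because k differs from i, and the right side gives 0 because i is neither
      \<open>i4\<close> nor \<open>i5\<close>; but s = 0 would make \<open>c i4\<close>
      fixed.\<close>
    have "s *\<^sub>R (c i - c k) = r *\<^sub>R (c i4 - c i5)"
      unfolding r s by (simp add: mult.commute)
    then have "coeff i (s *\<^sub>R (c i - c k)) = coeff i (r *\<^sub>R (c i4 - c i5))"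
      by simp
    then have "s = 0"
      using i k(1) i4(1) i5(1) ne k(2)
      by (simp add: linear_cmul[OF linear_coeff] linear_diff[OF linear_coeff] coeff_basis split: if_splits)
    then show False
      using s i4(2) i5(2) by simp
  qed
  have ne: "i4 \<noteq> i5" "i0 \<noteq> i4" "i0 \<noteq> i5"
    using i4(2) i5(2) i54 i0(2) by (auto simp del: alg_star.simps simp: alg_star_unit)
  \<comment> \<open>Only positions 0, 4 and 5 are prescribed; positions 1, 2 and 3 receive the
    remaining indices, all fixed by the involution.\<close>
  let ?f = "\<lambda>i::nat. if i = 0 then i0 else if i = 4 then i4 else i5"
  have "\<exists>\<sigma>. \<sigma> permutes {..5} \<and> (\<forall>x\<in>{0, 4, 5}. \<sigma> x = ?f x)"
    using ne i0 i4 i5 by (intro permutes_extend) (auto simp: inj_on_def)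
  then obtain \<sigma> where \<sigma>: "\<sigma> permutes {..5}" "\<sigma> 0 = i0" "\<sigma> 4 = i4" "\<sigma> 5 = i5"
    by auto
  show thesis
  proof (rule that[of \<sigma>])
    fix i :: nat
    assume i: "i \<in> {1, 2, 3}"
    then have "\<sigma> i \<le> 5"
      using permutes_in_image[OF \<sigma>(1), of i] by auto
    moreover have "\<sigma> i \<noteq> \<sigma> 4" "\<sigma> i \<noteq> \<sigma> 5"
      using i permutes_inj[OF \<sigma>(1)] by (auto simp: inj_eq)
    ultimately show "alg_star (c (\<sigma> i)) = c (\<sigma> i)"
      using fixed \<sigma> by simp
  qed (use \<sigma> i0 i5 in simp_all)
qed

section \<open>From one numbering to the existence of a numbering\<close>

theorem theorem2:
  fixes \<delta> \<phi> :: "nat \<Rightarrow> real" and B :: "nat \<Rightarrow> real^2^2" and b :: "nat \<Rightarrow> alg"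
  assumes "\<And>i. i \<le> 5 \<Longrightarrow> b i = (\<delta> i, \<phi> i, B i)"
    and "inj_on b {..5}" and "independent (b ` {..5})" and "span (b ` {..5}) = UNIV"
  shows "calg.standard_RBA_delta_basis (complexify ` b ` {..5}) calg_degree \<longleftrightarrow>
    (\<exists>\<sigma>. \<sigma> permutes {..5} \<and>
      (let \<delta>' = (\<lambda>i. \<delta> (\<sigma> i)); \<phi>' = (\<lambda>i. \<phi> (\<sigma> i)); B' = (\<lambda>i. B (\<sigma> i)); P = transition_matrix (\<lambda>i. b (\<sigma> i));
           n = (\<Sum>i\<le>5. \<delta>' i);
           m_phi = n / (\<Sum>i\<le>5. (\<phi>' i)\<^sup>2 / \<delta>' i);
           m_chi = (n - 1 - m_phi) / 2;
           m = (\<lambda>i::nat. if i = 0 then 1 else if i = 1 then m_phi else m_chi)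
       in
         ((\<forall>i\<le>5. \<delta>' i > 0) \<and> \<delta>' 0 = 1 \<and> \<phi>' 0 = 1 \<and> B' 0 = mat 1) \<and>
         (\<phi>' 5 = \<phi>' 4 \<and> \<delta>' 5 = \<delta>' 4 \<and>
          (\<forall>i\<in>{1, 2, 3}. transpose (B' i) = B' i) \<and> transpose (B' 4) = B' 5) \<and>
         (m_chi > 0 \<and>
          (\<forall>i\<le>5. \<forall>j\<le>5. weighted_form \<delta>' (P i) (P j) = n / m i * (if i = j then 1 else 0)))))"
    (is "?std \<longleftrightarrow> (\<exists>\<sigma>. \<sigma> permutes {..5} \<and> ?C \<sigma>)")
proof -
  interpret b: alg_basis b
    using assms(2-4) by unfold_locales
  \<comment> \<open>Standardness depends only on the set of basis elements, which \<sigma>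
    preserves. For fixed \<sigma> the conditions thus amount to standardness plus a suitable
    numbering, and only the existence of such a numbering remains.\<close>
  have numbered: "?C \<sigma> \<longleftrightarrow> ?std \<and> b (\<sigma> 0) = alg_unit \<and> alg_star (b (\<sigma> 4)) = b (\<sigma> 5) \<and>
      (\<forall>i\<in>{1, 2, 3}. alg_star (b (\<sigma> i)) = b (\<sigma> i))" if \<sigma>: "\<sigma> permutes {..5}" for \<sigma>
  proof -
    let ?c = "\<lambda>i. b (\<sigma> i)"
    have img: "?c ` {..5} = b ` {..5}"
      using permutes_image[OF \<sigma>] by (metis image_image)
    have "inj_on (b \<circ> \<sigma>) {..5}"
      using assms(2) permutes_image[OF \<sigma>] permutes_inj_on[OF \<sigma>] by (intro comp_inj_on) simp_all
    then interpret c: alg_basis ?c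
      using assms(3,4) by unfold_locales (simp_all add: img o_def)
    have c: "?c i = (\<delta> (\<sigma> i), \<phi> (\<sigma> i), B (\<sigma> i))" if "i \<le> 5" for i
      using assms(1) permutes_in_image[OF \<sigma>, of i] that by simp
    let ?num = "?c 0 = alg_unit \<and> alg_star (?c 4) = ?c 5 \<and>
      (\<forall>i\<in>{1, 2, 3}. alg_star (?c i) = ?c i)"
    have num: "?num \<longleftrightarrow> \<delta> (\<sigma> 0) = 1 \<and> \<phi> (\<sigma> 0) = 1 \<and> B (\<sigma> 0) = mat 1 \<and>
        \<phi> (\<sigma> 5) = \<phi> (\<sigma> 4) \<and> \<delta> (\<sigma> 5) = \<delta> (\<sigma> 4) \<and>
        (\<forall>i\<in>{1, 2, 3}. transpose (B (\<sigma> i)) = B (\<sigma> i)) \<and> transpose (B (\<sigma> 4)) = B (\<sigma> 5)"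
      by (auto simp: c)
    have star: "alg_star ` ?c ` {..5} = ?c ` {..5}" if ?num
    proof -
      have "alg_star (?c 5) = ?c 4"
        using that by (metis alg_star_star)
      with that show ?thesis
        by (auto simp: atMost_5 alg_star_unit simp del: alg_star.simps)
    qed
    show ?thesis
    proof (cases ?num)
      case True
      then show ?thesis
        using num c.standard_iff_orthogonality[OF c _ star[OF True]]
        by (simp add: img Let_def)
    next
      case False
      then show ?thesis
        using num by (auto simp: Let_def)
    qed
  qed
  show ?thesis
  proof
    assume std: ?std
    then have "alg_unit \<in> b ` {..5}" "alg_star ` b ` {..5} = b ` {..5}"
      using standard_complexify_iff[OF finite_imageI[OF finite_atMost] assms(3,4)] by simp_all
    then obtain \<sigma> where "\<sigma> permutes {..5}" "b (\<sigma> 0) = alg_unit" "alg_star (b (\<sigma> 4)) = b (\<sigma> 5)"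
      "\<And>i. i \<in> {1, 2, 3} \<Longrightarrow> alg_star (b (\<sigma> i)) = b (\<sigma> i)"
      by (rule b.star_closed_numbering) blast
    then show "\<exists>\<sigma>. \<sigma> permutes {..5} \<and> ?C \<sigma>"
      using std numbered by blast
  next
    assume "\<exists>\<sigma>. \<sigma> permutes {..5} \<and> ?C \<sigma>"
    then show ?std
      using numbered by blast
  qed
qed

end
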